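(* Let $(\mathbf{c},A,\mathbf{b})$ be an LP with $m$ constraints and $n$ variables, and let $\mathbf{x}^*_{\mathrm{LP}}$ denote the optimal solution. There is a set of at most $m^n$ hyperplanes and at most $m^{2n}$ degree-$2$ polynomial hypersurfaces partitioning $\mathbb{R}^{n+1}$ into connected components such that for each component $C$, one of the following holds: either (1) $\mathbf{x}^*_{\mathrm{LP}}(\boldsymbol{\alpha}^T\mathbf{x}\le\beta)=\mathbf{x}^*_{\mathrm{LP}}$ or (2) there is a set of constraints $E\subseteq M$ with $|E|=n-1$ such that $$\mathbf{x}^*_{\mathrm{LP}}(\boldsymbol{\alpha}^T\mathbf{x}\le\beta)=\left(\frac{\det(A^1_{E,\boldsymbol{\alpha},\beta})}{\det(A_{E,\boldsymbol{\alpha}})},\ldots,\frac{\det(A^n_{E,\boldsymbol{\alpha},\beta})}{\det(A_{E,\boldsymbol{\alpha}})}\right)$$ for all $(\boldsymbol{\alpha},\beta)\in C$.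
   Context: The LP $(\mathbf{c},A,\mathbf{b})$, with $\mathbf{c}\in\mathbb{R}^n$, $A\in\mathbb{Z}^{m\times n}$, $\mathbf{b}\in\mathbb{Z}^m$, is $\max\{\mathbf{c}^T\mathbf{x}: A\mathbf{x}\le\mathbf{b},\ \mathbf{x}\ge\mathbf{0}\}$. Its feasible region is assumed to be a rational polytope (a bounded polyhedron that can be described by linear inequalities with integer coefficients). $M=[m]$ denotes the set of $m$ constraints. A cut $\boldsymbol{\alpha}^T\mathbf{x}\le\beta$, with $\boldsymbol{\alpha}\in\mathbb{R}^n$ and $\beta\in\mathbb{R}$, is identified with its parameters $(\boldsymbol{\alpha},\beta)\in\mathbb{R}^{n+1}$. $\mathbf{x}^*_{\mathrm{LP}}(\boldsymbol{\alpha}^T\mathbf{x}\le\beta)\in\mathbb{R}^n$ denotes the optimal solution of the LP when the constraint $\boldsymbol{\alpha}^T\mathbf{x}\le\beta$ is added. For $E\subseteq M$, $A_E\in\mathbb{R}^{|E|\times n}$ and $\mathbf{b}_E\in\mathbb{R}^{|E|}$ denote the restrictions of $A$ and $\mathbf{b}$ to $E$. For $E\subseteq M$ with $|E|=n-1$, $A_{E,\boldsymbol{\alpha}}\in\mathbb{R}^{n\times n}$ denotes the matrix obtained by adding the row vector $\boldsymbol{\alpha}$ to $A_E$, and $A^i_{E,\boldsymbol{\alpha},\beta}\in\mathbb{R}^{n\times n}$ is the matrix $A_{E,\boldsymbol{\alpha}}$ with the $i$th column replaced by $(\mathbf{b}_E,\beta)^T$. A degree-$d$ polynomial hypersurface in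 $\mathbb{R}^k$ is the zero set of a polynomial of degree at most $d$. A finite set of hypersurfaces $\{p_j=0\}$ partitions $\mathbb{R}^k$ into connected components: the maximal connected subsets on which each $p_j$ is either identically zero or nowhere zero (so components lying on the hypersurfaces are included).
   Formalization: The m constraints are assumed to imply x ≥ 0 (nonnegativity counted in M; false otherwise); only components containing a cut that leaves the LP feasible are treated; "the optimal solution" with a cut is read as "an optimal solution", since ties can occur. *)

theory Defs
  imports "HOL-Analysis.Analysis"
begin

section \<open>Linear programs and cuts\<close>

definition real_mat :: "int ^ 'n ^ 'm \<Rightarrow> real ^ 'n ^ 'm" where
  "real_mat A = (\<chi> i j. real_of_int (A $ i $ j))"

definition real_vec :: "int ^ 'm \<Rightarrow> real ^ 'm" where
  "real_vec b = (\<chi> i. real_of_int (b $ i))"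

text \<open>The order on vectors is the componentwise one.\<close>

definition lp_feasible :: "int ^ 'n ^ 'm \<Rightarrow> int ^ 'm \<Rightarrow> (real ^ 'n) set" where
  "lp_feasible A b = {x. real_mat A *v x \<le> real_vec b \<and> 0 \<le> x}"

definition lp_optimal :: "real ^ 'n \<Rightarrow> int ^ 'n ^ 'm \<Rightarrow> int ^ 'm \<Rightarrow> real ^ 'n \<Rightarrow> bool" where
  "lp_optimal c A b x \<longleftrightarrow> is_arg_max (\<lambda>y. c \<bullet> y) (\<lambda>y. y \<in> lp_feasible A b) x"

definition cut_feasible ::
  "int ^ 'n ^ 'm \<Rightarrow> int ^ 'm \<Rightarrow> real ^ 'n \<Rightarrow> real \<Rightarrow> (real ^ 'n) set" where
  "cut_feasible A b \<alpha> \<beta> = lp_feasible A b \<inter> {x. \<alpha> \<bullet> x \<le> \<beta>}"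

text \<open>
  An optimal solution of the program with a cut added need not be unique (take \<open>\<alpha>\<close> to be a
  positive multiple of \<open>c\<close>) and need not exist (the cut may remove the whole feasible region), so
  being an optimal solution is a predicate rather than a function of the cut.
\<close>

definition cut_optimal ::
  "real ^ 'n \<Rightarrow> int ^ 'n ^ 'm \<Rightarrow> int ^ 'm \<Rightarrow> real ^ 'n \<Rightarrow> real \<Rightarrow> real ^ 'n \<Rightarrow> bool" where
  "cut_optimal c A b \<alpha> \<beta> x \<longleftrightarrow>
     is_arg_max (\<lambda>y. c \<bullet> y) (\<lambda>y. y \<in> cut_feasible A b \<alpha> \<beta>) x"


section \<open>The square systems attached to a set of constraints\<close>

text \<open>
  Square matrices have their rows indexed by the type \<open>'n\<close>, so the rows of the system formed by
  the constraints in \<open>E\<close> and the cut are distributed over \<open>'n\<close> by a fixed bijection, with \<open>None\<close>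
  standing for the cut. Another bijection would change the determinants below by a common sign
  only, and hence leaves their quotients unchanged.
\<close>

definition row_label :: "'m set \<Rightarrow> 'n \<Rightarrow> 'm option" where
  "row_label E = (SOME f. bij_betw f UNIV (insert None (Some ` E)))"

lemma bij_betw_row_label:
  fixes E :: "'m::finite set"
  assumes "card E = CARD('n::finite) - 1"
  shows "bij_betw (row_label E :: 'n \<Rightarrow> 'm option) UNIV (insert None (Some ` E))"
proof -
  have "card (insert None (Some ` E)) = Suc (card E)"
    by (subst card_insert_disjoint) (auto simp: card_image)
  also have "\<dots> = CARD('n)"
    using assms zero_less_card_finite[where 'a = 'n] by simp
  finally have "\<exists>f :: 'n \<Rightarrow> 'm option. bij_betw f UNIV (insert None (Some ` E))"
    by (intro finite_same_card_bij) auto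
  then show ?thesis
    unfolding row_label_def by (rule someI_ex)
qed

definition cut_matrix :: "int ^ 'n ^ 'm \<Rightarrow> 'm set \<Rightarrow> real ^ 'n \<Rightarrow> real ^ 'n ^ 'n" where
  "cut_matrix A E \<alpha> =
     (\<chi> r. case row_label E r of None \<Rightarrow> \<alpha> | Some k \<Rightarrow> real_mat A $ k)"

definition cut_rhs :: "int ^ 'm \<Rightarrow> 'm set \<Rightarrow> real \<Rightarrow> real ^ 'n" where
  "cut_rhs b E \<beta> =
     (\<chi> r. case row_label E r of None \<Rightarrow> \<beta> | Some k \<Rightarrow> real_vec b $ k)"

definition cut_matrix_col ::
  "int ^ 'n ^ 'm \<Rightarrow> int ^ 'm \<Rightarrow> 'm set \<Rightarrow> real ^ 'n \<Rightarrow> real \<Rightarrow> 'n \<Rightarrow> real ^ 'n ^ 'n" where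
  "cut_matrix_col A b E \<alpha> \<beta> i =
     (\<chi> r j. if j = i then cut_rhs b E \<beta> $ r else cut_matrix A E \<alpha> $ r $ j)"

definition cramer_point ::
  "int ^ 'n ^ 'm \<Rightarrow> int ^ 'm \<Rightarrow> 'm set \<Rightarrow> real ^ 'n \<Rightarrow> real \<Rightarrow> real ^ 'n" where
  "cramer_point A b E \<alpha> \<beta> =
     (\<chi> i. det (cut_matrix_col A b E \<alpha> \<beta> i) / det (cut_matrix A E \<alpha>))"


section \<open>Hypersurfaces and the components they define\<close>

text \<open>
  Real polynomial functions of degree at most \<open>d\<close>, following the definition of
  \<open>real_polynomial_function\<close>.
\<close>

inductive polynomial_degree_le :: "nat \<Rightarrow> ('a::euclidean_space \<Rightarrow> real) \<Rightarrow> bool" where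
  const: "polynomial_degree_le 0 (\<lambda>x. a)"
| linear: "bounded_linear f \<Longrightarrow> polynomial_degree_le 1 f"
| add: "polynomial_degree_le d f \<Longrightarrow> polynomial_degree_le d g \<Longrightarrow>
    polynomial_degree_le d (\<lambda>x. f x + g x)"
| mult: "polynomial_degree_le d f \<Longrightarrow> polynomial_degree_le e g \<Longrightarrow>
    polynomial_degree_le (d + e) (\<lambda>x. f x * g x)"
| mono: "polynomial_degree_le d f \<Longrightarrow> d \<le> e \<Longrightarrow> polynomial_degree_le e f"

definition hyperplane :: "'a::euclidean_space set \<Rightarrow> bool" where
  "hyperplane S \<longleftrightarrow> (\<exists>w t. w \<noteq> 0 \<and> S = {z. w \<bullet> z = t})"

definition polynomial_hypersurface :: "nat \<Rightarrow> 'a::euclidean_space set \<Rightarrow> bool" where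
  "polynomial_hypersurface d S \<longleftrightarrow> (\<exists>p. polynomial_degree_le d p \<and> S = {z. p z = 0})"

text \<open>
  A polynomial is identically zero on \<open>C\<close> iff \<open>C\<close> is contained in its zero set, and nowhere zero on
  \<open>C\<close> iff \<open>C\<close> is disjoint from it.
\<close>

definition unseparated :: "'a::euclidean_space set set \<Rightarrow> 'a set \<Rightarrow> bool" where
  "unseparated \<S> C \<longleftrightarrow> connected C \<and> (\<forall>S\<in>\<S>. C \<subseteq> S \<or> C \<inter> S = {})"

definition partition_component :: "'a::euclidean_space set set \<Rightarrow> 'a set \<Rightarrow> bool" where
  "partition_component \<S> C \<longleftrightarrow>
     unseparated \<S> C \<and> (\<forall>D. unseparated \<S> D \<and> C \<subseteq> D \<longrightarrow> D = C)"

end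

theory Submission
  imports Defs
begin

text \<open>
  Two cases are to be distinguished for a cut. If it keeps the given optimum \<open>x_LP\<close>, then \<open>x_LP\<close>
  stays optimal. If it removes \<open>x_LP\<close>, then on the segment from a surviving feasible point to \<open>x_LP\<close>
  the objective does not decrease, so the optimum is attained on the slice of the polytope by the
  hyperplane of the cut. The slice is a polytope, so its optimum is attained at an extreme point
  (\<open>linear_max_at_extreme_point\<close>); there the active constraints together with the cut have full
  rank (\<open>extreme_point_of_slice_span\<close>), and so \<open>n - 1\<close> of them, a set \<open>E\<close>, determine the point by
  Cramer's rule (\<open>ex_optimal_crossing\<close>): the optimum is the point where the hyperplane of the cut
  meets the line on which the constraints in \<open>E\<close> are tight.

  Which \<open>E\<close> is the right one is decided by the signs of finitely many polynomials in
  \<open>(\<alpha>, \<beta>)\<close>. The Cramer numerators and the denominator of \<open>E\<close> are linear forms, because only one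
  row of the matrices depends on the cut. Hence, after clearing denominators, the following hold:

    \<^item> the Cramer point of \<open>E\<close> satisfies constraint \<open>k\<close> according to the sign of a linear form and
      the sign of the denominator, one linear form for each of the at most \<open>m\<^sup>n\<^sup>-\<^sup>1 \<cdot> m\<close> pairs
      \<open>(E, k)\<close>, which give the hyperplanes;

    \<^item> the Cramer points of \<open>E\<close> and \<open>E'\<close> are compared by the sign of a quadratic form and the signs
      of the denominators.

  The hypersurfaces are the zero sets of these quadratic forms and of the denominators, and the set
  of the cuts whose hyperplane contains \<open>x_LP\<close>. As a nonempty bounded polyhedron has \<open>m \<ge> 2\<close>
  constraints, there is enough room for them within \<open>m\<^sup>2\<^sup>n\<close>. All these signs are constant on a
  component, so if the Cramer point of \<open>E\<close> is feasible at one cut of the component, it is so at every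
  other one; in particular, no cut of the component removes the whole polytope unless all do. If it
  is moreover optimal at one cut, it is so at every other one, because there the optimum is the
  Cramer point of some \<open>E'\<close>, which is feasible at the first cut too and was compared with \<open>E\<close> there.
\<close>


section \<open>Signs on the components of a partition\<close>

text \<open>
  A sign change would produce a zero by connectedness. Functions that vanish identically are
  admitted separately, since their zero set is the whole space and not a hyperplane.
\<close>

lemma unseparated_sgn_constant:
  fixes f :: "'a::euclidean_space \<Rightarrow> real"
  assumes C: "unseparated \<S> C" and f: "{z. f z = 0} \<in> \<S> \<or> (\<forall>z. f z = 0)"
    and cont: "continuous_on UNIV f" and z: "z \<in> C" "z' \<in> C"
  shows "sgn (f z) = sgn (f z')"
proof -
  have "C \<subseteq> {z. f z = 0} \<or> C \<inter> {z. f z = 0} = {}"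
    using C f unfolding unseparated_def by auto
  then consider "\<forall>z\<in>C. f z = 0" | "\<forall>z\<in>C. f z \<noteq> 0"
    by auto
  then show ?thesis
  proof cases
    case 1
    then show ?thesis using z by simp
  next
    case 2
    have "connected (f ` C)"
      using C cont unfolding unseparated_def
      by (meson connected_continuous_image continuous_on_subset subset_UNIV)
    then have iv: "{f u..f v} \<subseteq> f ` C" if "u \<in> C" "v \<in> C" for u v
      using that by (intro connected_contains_Icc) auto
    have "\<not> (f u < 0 \<and> 0 < f v)" if "u \<in> C" "v \<in> C" for u v
    proof
      assume "f u < 0 \<and> 0 < f v"
      then have "0 \<in> {f u..f v}" by simp
      with iv[OF that] obtain w where "w \<in> C" "f w = 0"
        by (metis imageE subsetD)
      with 2 show False by simp
    qed
    moreover have "f z \<noteq> 0" "f z' \<noteq> 0"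
      using 2 z by auto
    ultimately show ?thesis
      using z by (metis linorder_neqE_linordered_idom sgn_neg sgn_pos)
  qed
qed

lemma hyperplane_linear_zero_set:
  fixes f :: "'a::euclidean_space \<Rightarrow> real"
  assumes f: "linear f" and nz: "\<exists>z. f z \<noteq> 0"
  shows "hyperplane {z. f z = 0}"
proof -
  have eq: "f z = adjoint f 1 \<bullet> z" for z
    using adjoint_works[OF f, of z 1] by (simp add: inner_commute)
  then have "adjoint f 1 \<noteq> 0"
    using nz by force
  then show ?thesis
    unfolding hyperplane_def using eq by (intro exI[of _ "adjoint f 1"] exI[of _ 0]) auto
qed

lemma polynomial_degree_le_linear:
  fixes f :: "'a::euclidean_space \<Rightarrow> real"
  assumes "linear f"
  shows "polynomial_degree_le 1 f"
  using assms by (intro polynomial_degree_le.linear) (simp add: linear_conv_bounded_linear)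

lemma polynomial_degree_le_diff:
  assumes "polynomial_degree_le d f" "polynomial_degree_le d g"
  shows "polynomial_degree_le d (\<lambda>z. f z - g z)"
proof -
  have "polynomial_degree_le (0 + d) (\<lambda>z. (- 1) * g z)"
    by (intro polynomial_degree_le.mult polynomial_degree_le.const assms)
  then have "polynomial_degree_le d (\<lambda>z. f z + (- 1) * g z)"
    using assms by (intro polynomial_degree_le.add) auto
  then show ?thesis by simp
qed

lemma polynomial_hypersurface_linear_zero_set:
  fixes f :: "'a::euclidean_space \<Rightarrow> real"
  assumes "linear f"
  shows "polynomial_hypersurface 2 {z. f z = 0}"
  unfolding polynomial_hypersurface_def
  using polynomial_degree_le.mono[OF polynomial_degree_le_linear[OF assms], of 2] by auto


section \<open>Linear programs over a slice of a polyhedron\<close>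

lemma linear_max_at_extreme_point:
  fixes S :: "'a::euclidean_space set"
  assumes S: "compact S" "convex S" "S \<noteq> {}"
  obtains x where "x extreme_point_of S" "\<And>y. y \<in> S \<Longrightarrow> c \<bullet> y \<le> c \<bullet> x"
proof -
  obtain w where w: "w \<in> S" "\<And>y. y \<in> S \<Longrightarrow> c \<bullet> y \<le> c \<bullet> w"
    using continuous_attains_sup[OF S(1) S(3), of "\<lambda>y. c \<bullet> y"]
      continuous_on_inner[OF continuous_on_const continuous_on_id] by blast
  \<comment> \<open>The maximisers form a face, and an extreme point of a face is one of \<open>S\<close>.\<close>
  define F where "F = S \<inter> {y. c \<bullet> y = c \<bullet> w}"
  have face: "F face_of S"
    unfolding F_def using S(2) w(2) by (rule face_of_Int_supporting_hyperplane_le)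
  have "compact F" "convex F" "F \<noteq> {}"
    using S w(1) face by (auto simp: F_def compact_Int_closed closed_hyperplane
        intro: convex_Int convex_hyperplane)
  then obtain x where "x extreme_point_of F"
    using extreme_point_exists_convex by blast
  then have "x extreme_point_of S" "x \<in> F"
    using extreme_point_of_face[OF face] by auto
  then show thesis
    using w(2) by (intro that[of x]) (auto simp: F_def)
qed

text \<open>
  A direction orthogonal to \<open>\<alpha>\<close> and to all active constraints could be followed a little both ways
  without leaving the slice, since the inactive constraints have positive slack.
\<close>

lemma extreme_point_of_slice_span:
  fixes a :: "'m::finite \<Rightarrow> 'a::euclidean_space"
  assumes x: "x extreme_point_of {y. (\<forall>k. a k \<bullet> y \<le> b k) \<and> \<alpha> \<bullet> y = \<beta>}"
  shows "span (insert \<alpha> (a ` {k. a k \<bullet> x = b k})) = UNIV"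
proof (rule ccontr)
  let ?S = "{y. (\<forall>k. a k \<bullet> y \<le> b k) \<and> \<alpha> \<bullet> y = \<beta>}"
  assume "\<not> ?thesis"
  then obtain d where d: "d \<noteq> 0"
    and orth: "\<And>v. v \<in> span (insert \<alpha> (a ` {k. a k \<bullet> x = b k})) \<Longrightarrow> d \<bullet> v = 0"
    using span_not_UNIV_orthogonal by blast
  have d\<alpha>: "\<alpha> \<bullet> d = 0"
    using orth[OF span_base, of \<alpha>] by (simp add: inner_commute)
  have da: "a k \<bullet> d = 0" if "a k \<bullet> x = b k" for k
    using orth[OF span_base, of "a k"] that by (auto simp: inner_commute)
  have xS: "x \<in> ?S"
    using x by (simp add: extreme_point_of_def)
  define U where "U = (\<Inter>k\<in>{k. a k \<bullet> x \<noteq> b k}. {y. a k \<bullet> y < b k})"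
  have "open U"
    unfolding U_def by (intro open_INT ballI open_halfspace_lt) simp
  moreover have "x \<in> U"
    using xS unfolding U_def by (auto simp: order_less_le)
  ultimately obtain e where e: "e > 0" "ball x e \<subseteq> U"
    by (meson open_contains_ball)
  define t where "t = e / (2 * norm d)"
  have t: "t > 0" "norm (t *\<^sub>R d) < e"
    using e(1) d by (auto simp: t_def)
  have in_S: "x + s *\<^sub>R d \<in> ?S" if "\<bar>s\<bar> = t" for s
  proof -
    have "x + s *\<^sub>R d \<in> U"
      using e(2) t that by (intro subsetD[OF e(2)]) (auto simp: dist_norm)
    then have "a k \<bullet> (x + s *\<^sub>R d) \<le> b k" for k
      using da[of k] by (cases "a k \<bullet> x = b k") (auto simp: U_def inner_add_right order_less_imp_le)
    moreover have "\<alpha> \<bullet> (x + s *\<^sub>R d) = \<beta>"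
      using xS d\<alpha> by (simp add: inner_add_right)
    ultimately show ?thesis by simp
  qed
  have "midpoint (x + (- t) *\<^sub>R d) (x + t *\<^sub>R d) = x"
    by (simp add: midpoint_def scaleR_2[symmetric, of x])
  moreover have "x + (- t) *\<^sub>R d \<noteq> x + t *\<^sub>R d"
    unfolding add_left_cancel scaleR_cancel_right using t(1) d by simp
  ultimately have "x \<in> open_segment (x + (- t) *\<^sub>R d) (x + t *\<^sub>R d)"
    by (metis midpoint_in_open_segment)
  moreover have "x + (- t) *\<^sub>R d \<in> ?S" "x + t *\<^sub>R d \<in> ?S"
    using t(1) by (intro in_S; simp)+
  ultimately show False
    using x unfolding extreme_point_of_def by blast
qed

text \<open>Steinitz exchange: \<open>\<alpha>\<close> can be completed to a basis by some of the vectors \<open>a k\<close>.\<close>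

lemma spanning_subfamily_of_card:
  fixes a :: "'m \<Rightarrow> real ^ 'n"
  assumes \<alpha>: "\<alpha> \<noteq> 0" and span: "span (insert \<alpha> (a ` K)) = UNIV"
  obtains E where "E \<subseteq> K" "card E = CARD('n) - 1" "span (insert \<alpha> (a ` E)) = UNIV"
proof -
  obtain B where B: "{\<alpha>} \<subseteq> B" "B \<subseteq> insert \<alpha> (a ` K)" "independent B"
    "insert \<alpha> (a ` K) \<subseteq> span B"
    using maximal_independent_subset_extend[of "{\<alpha>}" "insert \<alpha> (a ` K)"] \<alpha> by auto
  have spB: "span B = UNIV"
    using span_minimal[OF B(4) subspace_span] span by auto
  have "B - {\<alpha>} \<subseteq> a ` K"
    using B(2) by auto
  then obtain E where E: "E \<subseteq> K" "inj_on a E" "B - {\<alpha>} = a ` E"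
    by (auto simp: subset_image_inj)
  have "card B = CARD('n)"
    using dim_eq_card_independent[OF B(3)] dim_span[of B] spB by simp
  then have "card E = CARD('n) - 1"
    using card_image[OF E(2)] card_Diff_singleton[of \<alpha> B] E(3) B(1) by simp
  moreover have "insert \<alpha> (a ` E) = B"
    using E(3) B(1) by auto
  ultimately show thesis
    using that E(1) spB by simp
qed


section \<open>Cramer points as functions of the cut\<close>

definition constraint_region :: "int ^ 'n ^ 'm \<Rightarrow> int ^ 'm \<Rightarrow> (real ^ 'n) set" where
  "constraint_region A b = {x. \<forall>k. real_mat A $ k \<bullet> x \<le> real_vec b $ k}"

lemma constraint_region_eq: "constraint_region A b = {x. real_mat A *v x \<le> real_vec b}"
  by (simp add: constraint_region_def less_eq_vec_def matrix_vector_mul_component)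

definition cramer_num ::
  "int ^ 'n ^ 'm \<Rightarrow> int ^ 'm \<Rightarrow> 'm set \<Rightarrow> (real ^ 'n) \<times> real \<Rightarrow> real ^ 'n" where
  "cramer_num A b E z = (\<chi> i. det (cut_matrix_col A b E (fst z) (snd z) i))"

definition cramer_den :: "int ^ 'n ^ 'm \<Rightarrow> 'm set \<Rightarrow> (real ^ 'n) \<times> real \<Rightarrow> real" where
  "cramer_den A E z = det (cut_matrix A E (fst z))"

lemma cramer_point_eq:
  "cramer_point A b E (fst z) (snd z) = (1 / cramer_den A E z) *\<^sub>R cramer_num A b E z"
  by (simp add: cramer_point_def cramer_num_def cramer_den_def vec_eq_iff)

lemma cramer_point_unique:
  assumes "cramer_den A E z \<noteq> 0"
  shows "cut_matrix A E (fst z) *v x = cut_rhs b E (snd z) \<longleftrightarrow>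
    x = cramer_point A b E (fst z) (snd z)"
  using assms cramer[of "cut_matrix A E (fst z)" x "cut_rhs b E (snd z)"]
  by (simp add: cramer_den_def cramer_point_def cut_matrix_col_def)

lemma linear_det_row:
  fixes g :: "'a::real_vector \<Rightarrow> real ^ 'n" and R :: "'n \<Rightarrow> real ^ 'n"
  assumes g: "linear g"
  shows "linear (\<lambda>z. det (\<chi> i. if i = r then g z else R i))"
proof (rule linearI)
  show "det (\<chi> i. if i = r then g (x + y) else R i) =
      det (\<chi> i. if i = r then g x else R i) + det (\<chi> i. if i = r then g y else R i)" for x y
    unfolding linear_add[OF g] by (rule det_row_add)
  show "det (\<chi> i. if i = r then g (s *\<^sub>R x) else R i) =
      s *\<^sub>R det (\<chi> i. if i = r then g x else R i)" for s x
    using det_row_mul[of r s "\<lambda>_. g x" R]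
    unfolding linear_scale[OF g] by (simp add: scalar_mult_eq_scaleR cong: if_cong)
qed

lemma ex1_cut_row:
  fixes E :: "'m::finite set"
  assumes "card E = CARD('n::finite) - 1"
  obtains r :: "'n::finite" where "\<And>i. row_label E i = None \<longleftrightarrow> i = r"
proof -
  have bij: "bij_betw (row_label E :: 'n \<Rightarrow> 'm option) UNIV (insert None (Some ` E))"
    using assms by (rule bij_betw_row_label)
  then obtain r :: 'n where "row_label E r = None"
    by (metis bij_betw_imp_surj_on imageE insertI1)
  then have "row_label E i = None \<longleftrightarrow> i = r" for i :: 'n
    using bij by (metis bij_betw_imp_inj_on injD)
  then show thesis ..
qed

text \<open>
  Among the rows of the Cramer matrices, only that of the cut depends on \<open>(\<alpha>, \<beta>)\<close>, and this row is
  linear in \<open>(\<alpha>, \<beta>)\<close>, also when \<open>\<beta>\<close> replaces one of its entries.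
\<close>

lemma linear_cramer_den:
  fixes A :: "int ^ 'n ^ 'm"
  assumes E: "card E = CARD('n) - 1"
  shows "linear (cramer_den A E)"
proof -
  obtain r :: 'n where r: "\<And>i. row_label E i = None \<longleftrightarrow> i = r"
    using ex1_cut_row[OF E] by blast
  then have cut_row: "row_label E r = None"
    by simp
  let ?R = "\<lambda>i. case row_label E i of None \<Rightarrow> 0 | Some k \<Rightarrow> real_mat A $ k"
  have "cut_matrix A E (fst z) = (\<chi> i. if i = r then fst z else ?R i)" for z :: "(real ^ 'n) \<times> real"
    using r by (auto simp: cut_row cut_matrix_def vec_eq_iff split: option.split)
  then have "cramer_den A E = (\<lambda>z. det (\<chi> i. if i = r then fst z else ?R i))"
    by (simp add: fun_eq_iff cramer_den_def)
  then show ?thesis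
    by (simp add: linear_det_row linear_fst)
qed

lemma linear_cramer_num:
  fixes A :: "int ^ 'n ^ 'm"
  assumes E: "card E = CARD('n) - 1"
  shows "linear (cramer_num A b E)"
proof -
  obtain r :: 'n where r: "\<And>i. row_label E i = None \<longleftrightarrow> i = r"
    using ex1_cut_row[OF E] by blast
  then have cut_row: "row_label E r = None"
    by simp
  have lin: "linear (\<lambda>z. cramer_num A b E z $ j)" for j
  proof -
    let ?g = "\<lambda>z :: (real ^ 'n) \<times> real. (\<chi> l. if l = j then snd z else fst z $ l) :: real ^ 'n"
    let ?R = "\<lambda>i. (\<chi> l. case row_label E i of None \<Rightarrow> 0
      | Some k \<Rightarrow> if l = j then real_vec b $ k else real_mat A $ k $ l) :: real ^ 'n"
    have lin_g: "linear ?g"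
      by (rule linearI) (auto simp: vec_eq_iff)
    have "cut_matrix_col A b E (fst z) (snd z) j = (\<chi> i. if i = r then ?g z else ?R i)" for z
      using r by (auto simp: cut_row cut_matrix_col_def cut_matrix_def cut_rhs_def vec_eq_iff
          split: option.split)
    then have eq: "(\<lambda>z. cramer_num A b E z $ j) = (\<lambda>z. det (\<chi> i. if i = r then ?g z else ?R i))"
      by (simp add: fun_eq_iff cramer_num_def)
    show ?thesis
      unfolding eq using lin_g by (rule linear_det_row)
  qed
  show ?thesis
    using linear_add[OF lin] linear_scale[OF lin]
    by (intro linearI) (auto simp: vec_eq_iff)
qed

lemma linear_inner_cramer_num:
  fixes A :: "int ^ 'n ^ 'm"
  assumes "card E = CARD('n) - 1"
  shows "linear (\<lambda>z. v \<bullet> cramer_num A b E z)"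
  using linear_cramer_num[OF assms]
  by (intro linearI) (auto simp: linear_add linear_scale inner_add_right)

text \<open>The violation of constraint \<open>k\<close> by the Cramer point, multiplied by the denominator.\<close>

definition violation_form ::
  "int ^ 'n ^ 'm \<Rightarrow> int ^ 'm \<Rightarrow> 'm set \<Rightarrow> 'm \<Rightarrow> (real ^ 'n) \<times> real \<Rightarrow> real" where
  "violation_form A b E k z =
     real_mat A $ k \<bullet> cramer_num A b E z - real_vec b $ k * cramer_den A E z"

text \<open>The difference of the objectives of two Cramer points, multiplied by both denominators.\<close>

definition objective_gap ::
  "real ^ 'n \<Rightarrow> int ^ 'n ^ 'm \<Rightarrow> int ^ 'm \<Rightarrow> 'm set \<Rightarrow> 'm set \<Rightarrow> (real ^ 'n) \<times> real \<Rightarrow> real" where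
  "objective_gap c A b E E' z =
     (c \<bullet> cramer_num A b E z) * cramer_den A E' z - (c \<bullet> cramer_num A b E' z) * cramer_den A E z"

lemma linear_violation_form:
  fixes A :: "int ^ 'n ^ 'm"
  assumes "card E = CARD('n) - 1"
  shows "linear (violation_form A b E k)"
  using linear_compose_sub[OF linear_inner_cramer_num[OF assms, of "real_mat A $ k" A b]
      linear_compose_scale_right[OF linear_cramer_den[OF assms, of A], of "real_vec b $ k"]]
  by (simp add: violation_form_def[abs_def])

lemma polynomial_degree_le_objective_gap:
  fixes A :: "int ^ 'n ^ 'm"
  assumes "card E = CARD('n) - 1" "card E' = CARD('n) - 1"
  shows "polynomial_degree_le 2 (objective_gap c A b E E')"
proof -
  have "polynomial_degree_le (1 + 1)
      (\<lambda>z. (c \<bullet> cramer_num A b F z) * cramer_den A G z)"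
    if "card F = CARD('n) - 1" "card G = CARD('n) - 1" for F G
    by (intro polynomial_degree_le.mult polynomial_degree_le_linear
        linear_inner_cramer_num linear_cramer_den that)
  then have "polynomial_degree_le (1 + 1) (\<lambda>z. (c \<bullet> cramer_num A b E z) * cramer_den A E' z
      - (c \<bullet> cramer_num A b E' z) * cramer_den A E z)"
    using assms by (intro polynomial_degree_le_diff) auto
  then show ?thesis
    by (simp add: objective_gap_def[abs_def] numeral_2_eq_2)
qed

lemma continuous_on_objective_gap:
  fixes A :: "int ^ 'n ^ 'm"
  assumes "card E = CARD('n) - 1" "card E' = CARD('n) - 1"
  shows "continuous_on UNIV (objective_gap c A b E E')"
  unfolding objective_gap_def[abs_def]
  using assms
  by (intro continuous_intros linear_continuous_on linear_conv_bounded_linear[THEN iffD1]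
      linear_cramer_num linear_cramer_den) auto

text \<open>
  Geometrically, the hyperplane of the cut crosses the line given by the constraints in \<open>E\<close> at a
  point of the polyhedron.
\<close>

definition crossing ::
  "int ^ 'n ^ 'm \<Rightarrow> int ^ 'm \<Rightarrow> 'm set \<Rightarrow> (real ^ 'n) \<times> real \<Rightarrow> bool" where
  "crossing A b E z \<longleftrightarrow> cramer_den A E z \<noteq> 0 \<and>
     cramer_point A b E (fst z) (snd z) \<in> constraint_region A b"

lemma scaled_le_iff_sgn:
  fixes p q d :: real
  assumes "d \<noteq> 0"
  shows "p / d \<le> q \<longleftrightarrow> sgn (p - q * d) * sgn d \<le> 0"
  using assms by (cases "d > 0") (auto simp: sgn_if divide_simps)

lemma crossing_iff_sgn:
  "crossing A b E z \<longleftrightarrow> cramer_den A E z \<noteq> 0 \<and>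
     (\<forall>k. sgn (violation_form A b E k z) * sgn (cramer_den A E z) \<le> 0)"
proof -
  have "real_mat A $ k \<bullet> cramer_point A b E (fst z) (snd z) =
      (real_mat A $ k \<bullet> cramer_num A b E z) / cramer_den A E z" for k
    by (simp add: cramer_point_eq)
  then show ?thesis
    unfolding crossing_def constraint_region_def violation_form_def
    using scaled_le_iff_sgn by auto
qed

lemma objective_le_iff_sgn:
  assumes "cramer_den A E z \<noteq> 0" "cramer_den A E' z \<noteq> 0"
  shows "c \<bullet> cramer_point A b E (fst z) (snd z) \<le> c \<bullet> cramer_point A b E' (fst z) (snd z) \<longleftrightarrow>
    sgn (objective_gap c A b E E' z) * sgn (cramer_den A E z) * sgn (cramer_den A E' z) \<le> 0"
proof -
  let ?d = "cramer_den A E z" and ?d' = "cramer_den A E' z"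
  let ?p = "c \<bullet> cramer_num A b E z" and ?p' = "c \<bullet> cramer_num A b E' z"
  have "?p / ?d - ?p' / ?d' = objective_gap c A b E E' z / (?d * ?d')"
    using assms by (simp add: objective_gap_def field_simps)
  then have "sgn (?p / ?d - ?p' / ?d') = sgn (objective_gap c A b E E' z) * sgn ?d * sgn ?d'"
    by (simp add: sgn_divide sgn_mult) (auto simp: sgn_if)
  moreover have "?p / ?d \<le> ?p' / ?d' \<longleftrightarrow> sgn (?p / ?d - ?p' / ?d') \<le> 0"
    by (auto simp: sgn_if)
  ultimately show ?thesis
    by (simp add: cramer_point_eq)
qed

lemma cramer_point_on_cut:
  fixes A :: "int ^ 'n ^ 'm"
  assumes E: "card E = CARD('n) - 1" and nz: "cramer_den A E z \<noteq> 0"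
  shows "fst z \<bullet> cramer_point A b E (fst z) (snd z) = snd z"
proof -
  obtain r :: 'n where r: "\<And>i. row_label E i = None \<longleftrightarrow> i = r"
    using ex1_cut_row[OF E] by blast
  have "cut_matrix A E (fst z) *v cramer_point A b E (fst z) (snd z) = cut_rhs b E (snd z)"
    using cramer_point_unique[OF nz] by blast
  then have "(cut_matrix A E (fst z) *v cramer_point A b E (fst z) (snd z)) $ r =
      cut_rhs b E (snd z) $ r"
    by simp
  moreover have "row_label E r = None"
    using r by simp
  ultimately show ?thesis
    by (simp add: matrix_vector_mul_component cut_matrix_def cut_rhs_def)
qed

lemma cramer_den_nonzero:
  fixes A :: "int ^ 'n ^ 'm"
  assumes E: "card E = CARD('n) - 1"
    and span: "span (insert (fst z) ((\<lambda>k. real_mat A $ k) ` E)) = UNIV"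
  shows "cramer_den A E z \<noteq> 0"
proof -
  let ?M = "cut_matrix A E (fst z)"
  have surj: "range (row_label E :: 'n \<Rightarrow> 'm option) = insert None (Some ` E)"
    using bij_betw_row_label[OF E] by (rule bij_betw_imp_surj_on)
  have rows: "\<exists>i. ?M $ i = v" if "v \<in> insert (fst z) ((\<lambda>k. real_mat A $ k) ` E)" for v
  proof -
    have "v \<in> (\<lambda>l. case l of None \<Rightarrow> fst z | Some k \<Rightarrow> real_mat A $ k) ` insert None (Some ` E)"
      using that by (simp add: image_image)
    then obtain l where l: "l \<in> insert None (Some ` E)"
      and v: "v = (case l of None \<Rightarrow> fst z | Some k \<Rightarrow> real_mat A $ k)"
      by blast
    obtain i :: 'n where "row_label E i = l"
      using l surj by (metis imageE)
    then show ?thesis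
      using v by (intro exI[of _ i]) (simp add: cut_matrix_def)
  qed
  have "x = 0" if x: "?M *v x = 0" for x
  proof -
    have row: "?M $ i \<bullet> x = 0" for i
      using x by (metis matrix_vector_mul_component zero_index)
    have "orthogonal x v" if "v \<in> insert (fst z) ((\<lambda>k. real_mat A $ k) ` E)" for v
      using rows[OF that] row by (auto simp: orthogonal_def inner_commute)
    then have "orthogonal x v" if "v \<in> span (insert (fst z) ((\<lambda>k. real_mat A $ k) ` E))" for v
      using that orthogonal_to_span by blast
    then show "x = 0"
      using span by (metis UNIV_I orthogonal_self)
  qed
  then have "invertible ?M"
    using matrix_left_invertible_ker[of ?M] by (auto simp: invertible_left_inverse)
  then show ?thesis
    by (simp add: cramer_den_def invertible_det_nz)
qed

text \<open>
  Moving from a feasible point \<open>y\<close> of the cut towards \<open>x_LP\<close>, which the cut removes, one meets the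
  cut hyperplane, and the objective does not decrease on the way. So the maximum over the slice
  dominates the whole region that the cut leaves, and it is attained at an extreme point.
\<close>

lemma ex_optimal_crossing:
  fixes A :: "int ^ 'n ^ 'm"
  assumes bounded: "bounded (constraint_region A b)"
    and x_LP: "x_LP \<in> constraint_region A b"
    and opt: "\<And>y. y \<in> constraint_region A b \<Longrightarrow> c \<bullet> y \<le> c \<bullet> x_LP"
    and removed: "fst z \<bullet> x_LP > snd z"
    and ne: "y0 \<in> constraint_region A b" "fst z \<bullet> y0 \<le> snd z"
  obtains E where "card E = CARD('n) - 1" "crossing A b E z"
    "\<And>y. y \<in> constraint_region A b \<Longrightarrow> fst z \<bullet> y \<le> snd z \<Longrightarrow>
      c \<bullet> y \<le> c \<bullet> cramer_point A b E (fst z) (snd z)"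
proof -
  let ?P = "constraint_region A b" and ?a = "\<lambda>k. real_mat A $ k"
  define S where "S = {y. (\<forall>k. ?a k \<bullet> y \<le> real_vec b $ k) \<and> fst z \<bullet> y = snd z}"
  have SP: "S = ?P \<inter> {y. fst z \<bullet> y = snd z}"
    by (auto simp: S_def constraint_region_def)
  have Peq: "?P = (\<Inter>k. {y. ?a k \<bullet> y \<le> real_vec b $ k})"
    by (auto simp: constraint_region_def)
  have convP: "convex ?P"
    unfolding Peq by (intro convex_INT convex_halfspace_le)
  have "closed ?P"
    unfolding Peq by (intro closed_INT ballI closed_halfspace_le)
  then have S_cc: "compact S" "convex S"
    using bounded convP unfolding SP
    by (auto simp: compact_eq_bounded_closed closed_hyperplane intro: convex_Int convex_hyperplane)
  have push: "\<exists>w\<in>S. c \<bullet> y \<le> c \<bullet> w" if y: "y \<in> ?P" "fst z \<bullet> y \<le> snd z" for y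
  proof -
    define t where "t = (snd z - fst z \<bullet> y) / (fst z \<bullet> x_LP - fst z \<bullet> y)"
    have t: "0 \<le> t" "t \<le> 1"
      using y(2) removed by (auto simp: t_def)
    define w where "w = (1 - t) *\<^sub>R y + t *\<^sub>R x_LP"
    have "fst z \<bullet> w = fst z \<bullet> y + t * (fst z \<bullet> x_LP - fst z \<bullet> y)"
      by (simp add: w_def algebra_simps)
    also have "\<dots> = snd z"
      using y(2) removed by (simp add: t_def)
    finally have "w \<in> S"
      using convexD_alt[OF convP y(1) x_LP t] by (simp add: SP w_def)
    moreover have "c \<bullet> w = c \<bullet> y + t * (c \<bullet> x_LP - c \<bullet> y)"
      by (simp add: w_def algebra_simps)
    then have "c \<bullet> y \<le> c \<bullet> w"
      using t(1) opt[OF y(1)] by simp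
    ultimately show ?thesis by blast
  qed
  have "S \<noteq> {}"
    using push[OF ne] by blast
  then obtain x where x: "x extreme_point_of S" and xmax: "\<And>y. y \<in> S \<Longrightarrow> c \<bullet> y \<le> c \<bullet> x"
    using linear_max_at_extreme_point[OF S_cc] by metis
  have xS: "x \<in> S"
    using x by (simp add: extreme_point_of_def)
  have "span (insert (fst z) (?a ` {k. ?a k \<bullet> x = real_vec b $ k})) = UNIV"
    using x unfolding S_def by (rule extreme_point_of_slice_span)
  moreover have "fst z \<noteq> 0"
    using removed ne(2) by auto
  ultimately obtain E where E: "E \<subseteq> {k. ?a k \<bullet> x = real_vec b $ k}" "card E = CARD('n) - 1"
    and sp: "span (insert (fst z) (?a ` E)) = UNIV"
    using spanning_subfamily_of_card[of "fst z" ?a "{k. ?a k \<bullet> x = real_vec b $ k}"] by blast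
  have nz: "cramer_den A E z \<noteq> 0"
    using E(2) sp by (rule cramer_den_nonzero)
  have "row_label E i \<in> insert None (Some ` E)" for i :: 'n
    using bij_betw_row_label[OF E(2)] by (meson bij_betwE UNIV_I)
  then have "?a k \<bullet> x = real_vec b $ k" if "row_label E (i :: 'n) = Some k" for i k
    using E(1) that by (metis (mono_tags, lifting) imageE insertE mem_Collect_eq option.distinct(1)
        option.inject subsetD)
  then have "(cut_matrix A E (fst z) *v x) $ i = cut_rhs b E (snd z) $ i" for i
    using xS by (auto simp: matrix_vector_mul_component cut_matrix_def cut_rhs_def S_def
        split: option.split)
  then have "cut_matrix A E (fst z) *v x = cut_rhs b E (snd z)"
    by (simp add: vec_eq_iff)
  then have x_eq: "x = cramer_point A b E (fst z) (snd z)"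
    using cramer_point_unique[OF nz] by blast
  show thesis
  proof (rule that)
    show "card E = CARD('n) - 1" by fact
    show "crossing A b E z"
      using nz xS x_eq by (simp add: crossing_def SP)
    show "c \<bullet> y \<le> c \<bullet> cramer_point A b E (fst z) (snd z)"
      if "y \<in> ?P" "fst z \<bullet> y \<le> snd z" for y
      using push[OF that] xmax x_eq by force
  qed
qed


section \<open>Counting\<close>

text \<open>
  A single constraint is satisfied along the whole ray from \<open>x\<close> against its normal, or along any
  ray if the normal is zero, so the region would be unbounded.
\<close>

lemma two_le_card_constraints:
  fixes A :: "int ^ 'n ^ 'm"
  assumes bounded: "bounded (constraint_region A b)" and x: "x \<in> constraint_region A b"
  shows "2 \<le> CARD('m)"
proof (rule ccontr)
  assume "\<not> ?thesis"
  then have "CARD('m) = 1"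
    using zero_less_card_finite[where 'a = 'm] by linarith
  then obtain k :: 'm where k: "UNIV = {k}"
    by (auto simp: card_1_singleton_iff)
  let ?a = "real_mat A $ k"
  obtain d :: "real ^ 'n" where d: "d \<noteq> 0" "?a \<bullet> d \<le> 0"
  proof (cases "?a = 0")
    case True
    then show ?thesis using that[of "axis undefined 1"] by (simp add: axis_eq_0_iff)
  next
    case False
    then show ?thesis using that[of "- ?a"] by simp
  qed
  have ray: "x + t *\<^sub>R d \<in> constraint_region A b" if "t \<ge> 0" for t
  proof -
    have "?a \<bullet> x \<le> real_vec b $ k" "t * (?a \<bullet> d) \<le> 0"
      using x d(2) that by (auto simp: constraint_region_def mult_nonneg_nonpos)
    then have "?a \<bullet> (x + t *\<^sub>R d) \<le> real_vec b $ k"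
      by (simp add: inner_add_right)
    moreover have "i = k" for i :: 'm
      using k by auto
    ultimately have "real_mat A $ i \<bullet> (x + t *\<^sub>R d) \<le> real_vec b $ i" for i
      by metis
    then show ?thesis
      by (simp add: constraint_region_def)
  qed
  obtain B where B: "\<And>y. y \<in> constraint_region A b \<Longrightarrow> norm y \<le> B"
    using bounded by (auto simp: bounded_iff)
  define t where "t = (B + norm x + 1) / norm d"
  have B0: "0 \<le> B"
    using B[OF x] norm_ge_zero[of x] by linarith
  then have t0: "t \<ge> 0"
    by (simp add: t_def)
  have "B + norm x + 1 = norm (t *\<^sub>R d)"
    using t0 d(1) B0 by (simp add: t_def)
  also have "\<dots> \<le> norm (x + t *\<^sub>R d) + norm x"
    using norm_triangle_ineq4[of "x + t *\<^sub>R d" x] by simp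
  also have "\<dots> \<le> B + norm x"
    using B[OF ray[OF t0]] by simp
  finally show False by simp
qed

lemma card_subsets_of_card_le:
  "card {E :: 'm::finite set. card E = k} \<le> CARD('m) ^ k"
proof -
  have "card {E :: 'm set. card E = k} = CARD('m) choose k"
    using n_subsets[of "UNIV :: 'm set" k] by simp
  also have "\<dots> \<le> CARD('m) ^ k"
    by (cases "k \<le> CARD('m)") (auto simp: binomial_le_pow binomial_eq_0)
  finally show ?thesis .
qed

text \<open>
  \<open>N\<close> is the number of sets \<open>E\<close>; there are \<open>N\<^sup>2\<close> quadratic forms, \<open>N\<close> denominators and one hyperplane
  for \<open>x_LP\<close>.
\<close>

lemma card_pairs_singles_one_le:
  fixes m n N :: nat
  assumes m: "2 \<le> m" and n: "0 < n" and N: "N \<le> m ^ (n - 1)"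
  shows "N * N + N + 1 \<le> m ^ (2 * n)"
proof -
  define p where "p = m ^ (n - 1)"
  have p: "1 \<le> p" "N \<le> p" "m ^ n = m * p"
    using m N power_minus_mult[OF n, of m] by (auto simp: p_def mult.commute)
  have "N * N + N + 1 \<le> p * p + p * p + p * p"
    using p by (intro add_mono mult_le_mono) (auto intro: order_trans[of _ p])
  also have "\<dots> \<le> (2 * p) * (2 * p)"
    by simp
  also have "\<dots> \<le> (m * p) * (m * p)"
    using m by (intro mult_le_mono) auto
  also have "\<dots> = m ^ (2 * n)"
    unfolding p(3)[symmetric] power_add[symmetric] mult_2 by (rule refl)
  finally show ?thesis .
qed


section \<open>The optimum on a component\<close>

theorem theorem3p1:
  fixes c :: "real ^ 'n"
    and A :: "int ^ 'n ^ 'm"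
    and b :: "int ^ 'm"
    and x_LP :: "real ^ 'n"
  assumes polytope: "bounded (lp_feasible A b)"
    and constraints_define_region: "lp_feasible A b = {x. real_mat A *v x \<le> real_vec b}"
    and optimal: "lp_optimal c A b x_LP"
  shows "\<exists>(\<H> :: ((real ^ 'n) \<times> real) set set) (\<Q> :: ((real ^ 'n) \<times> real) set set).
    finite \<H> \<and> card \<H> \<le> CARD('m) ^ CARD('n) \<and> (\<forall>S\<in>\<H>. hyperplane S) \<and>
    finite \<Q> \<and> card \<Q> \<le> CARD('m) ^ (2 * CARD('n)) \<and>
      (\<forall>S\<in>\<Q>. polynomial_hypersurface 2 S) \<and>
    (\<forall>C. partition_component (\<H> \<union> \<Q>) C \<and> (\<exists>(\<alpha>, \<beta>)\<in>C. cut_feasible A b \<alpha> \<beta> \<noteq> {}) \<longrightarrow>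
      (\<forall>(\<alpha>, \<beta>)\<in>C. cut_optimal c A b \<alpha> \<beta> x_LP) \<or>
      (\<exists>E :: 'm set. card E = CARD('n) - 1 \<and>
        (\<forall>(\<alpha>, \<beta>)\<in>C. det (cut_matrix A E \<alpha>) \<noteq> 0 \<and>
          cut_optimal c A b \<alpha> \<beta> (cramer_point A b E \<alpha> \<beta>))))"
proof -
  let ?P = "constraint_region A b"
  let ?\<E> = "{E :: 'm set. card E = CARD('n) - 1}"
  have P: "lp_feasible A b = ?P"
    using constraints_define_region by (simp add: constraint_region_eq)
  have bdd: "bounded ?P"
    using polytope P by simp
  have x_LP: "x_LP \<in> ?P" and opt: "\<And>y. y \<in> ?P \<Longrightarrow> c \<bullet> y \<le> c \<bullet> x_LP"
    using optimal P by (force simp: lp_optimal_def is_arg_max_def)+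

  \<comment> \<open>A violation form that vanishes identically defines no hyperplane, and its sign is constant
    anyway.\<close>
  define \<H> where "\<H> =
    (\<lambda>(E, k). {z. violation_form A b E k z = 0}) `
      {(E, k). E \<in> ?\<E> \<and> (\<exists>z. violation_form A b E k z \<noteq> 0)}"
  define keep where "keep z = fst z \<bullet> x_LP - snd z" for z :: "(real ^ 'n) \<times> real"
  define \<Q> where "\<Q> =
    (\<lambda>(E, E'). {z. objective_gap c A b E E' z = 0}) ` (?\<E> \<times> ?\<E>)
    \<union> (\<lambda>E. {z. cramer_den A E z = 0}) ` ?\<E> \<union> {{z. keep z = 0}}"

  have lin_keep: "linear keep"
    by (rule linearI) (auto simp: keep_def algebra_simps)
  have card_\<E>: "card ?\<E> \<le> CARD('m) ^ (CARD('n) - 1)"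
    by (rule card_subsets_of_card_le)

  have "card \<H> \<le> card (?\<E> \<times> (UNIV :: 'm set))"
    unfolding \<H>_def
    by (rule order_trans[OF card_image_le card_mono]) auto
  also have "\<dots> \<le> CARD('m) ^ (CARD('n) - 1) * CARD('m)"
    using card_\<E> by (simp add: card_cartesian_product)
  also have "\<dots> = CARD('m) ^ CARD('n)"
    by (rule power_minus_mult) simp
  finally have card_\<H>: "card \<H> \<le> CARD('m) ^ CARD('n)" .
  have hyper: "\<forall>S\<in>\<H>. hyperplane S"
    unfolding \<H>_def by (auto intro!: hyperplane_linear_zero_set linear_violation_form)

  have "card \<Q> \<le> card ?\<E> * card ?\<E> + card ?\<E> + 1"
    unfolding \<Q>_def
    by (intro order_trans[OF card_Un_le] add_mono order_trans[OF card_image_le])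
      (auto simp: card_cartesian_product)
  also have "\<dots> \<le> CARD('m) ^ (2 * CARD('n))"
    using two_le_card_constraints[OF bdd x_LP] card_\<E>
    by (intro card_pairs_singles_one_le) auto
  finally have card_\<Q>: "card \<Q> \<le> CARD('m) ^ (2 * CARD('n))" .
  have quad_gap: "polynomial_hypersurface 2 {z. objective_gap c A b E E' z = 0}"
    if "E \<in> ?\<E>" "E' \<in> ?\<E>" for E E'
    unfolding polynomial_hypersurface_def
    using polynomial_degree_le_objective_gap[of E E' c A b] that by auto
  have quad: "\<forall>S\<in>\<Q>. polynomial_hypersurface 2 S"
    unfolding \<Q>_def
    by (auto intro: quad_gap polynomial_hypersurface_linear_zero_set[OF lin_keep]
        polynomial_hypersurface_linear_zero_set[OF linear_cramer_den])

  have main: "(\<forall>(\<alpha>, \<beta>)\<in>C. cut_optimal c A b \<alpha> \<beta> x_LP) \<or>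
      (\<exists>E :: 'm set. card E = CARD('n) - 1 \<and>
        (\<forall>(\<alpha>, \<beta>)\<in>C. det (cut_matrix A E \<alpha>) \<noteq> 0 \<and>
          cut_optimal c A b \<alpha> \<beta> (cramer_point A b E \<alpha> \<beta>)))"
    if C: "partition_component (\<H> \<union> \<Q>) C" and ne: "\<exists>(\<alpha>, \<beta>)\<in>C. cut_feasible A b \<alpha> \<beta> \<noteq> {}" for C
  proof -
    have unsep: "unseparated (\<H> \<union> \<Q>) C"
      using C by (simp add: partition_component_def)
    have cut_opt: "cut_optimal c A b (fst z) (snd z) x \<longleftrightarrow> x \<in> ?P \<and> fst z \<bullet> x \<le> snd z \<and>
        (\<forall>y\<in>?P. fst z \<bullet> y \<le> snd z \<longrightarrow> c \<bullet> y \<le> c \<bullet> x)" for z x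
      by (force simp: cut_optimal_def is_arg_max_def cut_feasible_def P not_less)
    have sgn_keep: "sgn (keep z) = sgn (keep z')" if "z \<in> C" "z' \<in> C" for z z'
      using unsep _ _ that
      by (rule unseparated_sgn_constant)
        (auto simp: \<Q>_def intro!: linear_continuous_on linear_conv_bounded_linear[THEN iffD1] lin_keep)
    have sgn_den: "sgn (cramer_den A E z) = sgn (cramer_den A E z')"
      if "E \<in> ?\<E>" "z \<in> C" "z' \<in> C" for E z z'
      using unsep _ _ that(2,3)
      by (rule unseparated_sgn_constant)
        (use that(1) in \<open>auto simp: \<Q>_def intro!: linear_continuous_on linear_conv_bounded_linear[THEN iffD1]
          linear_cramer_den\<close>)
    have sgn_viol: "sgn (violation_form A b E k z) = sgn (violation_form A b E k z')"
      if "E \<in> ?\<E>" "z \<in> C" "z' \<in> C" for E k z z'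
      using unsep _ _ that(2,3)
    proof (rule unseparated_sgn_constant)
      show "{z. violation_form A b E k z = 0} \<in> \<H> \<union> \<Q> \<or> (\<forall>z. violation_form A b E k z = 0)"
        using that(1) by (auto simp: \<H>_def image_iff intro!: exI[of _ E] exI[of _ k])
      show "continuous_on UNIV (violation_form A b E k)"
        using that(1)
        by (auto intro!: linear_continuous_on linear_conv_bounded_linear[THEN iffD1] linear_violation_form)
    qed
    have sgn_gap: "sgn (objective_gap c A b E E' z) = sgn (objective_gap c A b E E' z')"
      if "E \<in> ?\<E>" "E' \<in> ?\<E>" "z \<in> C" "z' \<in> C" for E E' z z'
      using unsep _ _ that(3,4)
      by (rule unseparated_sgn_constant)
        (use that(1,2) in \<open>auto simp: \<Q>_def intro!: continuous_on_objective_gap\<close>)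
    have crossing_const: "crossing A b E z'" if "E \<in> ?\<E>" "z \<in> C" "z' \<in> C" "crossing A b E z" for E z z'
      using that(4) sgn_den[OF that(1-3)] sgn_viol[OF that(1-3)]
      unfolding crossing_iff_sgn by (metis sgn_eq_0_iff)

    obtain z0 y0 where z0: "z0 \<in> C" and y0: "y0 \<in> ?P" "fst z0 \<bullet> y0 \<le> snd z0"
      using ne by (auto simp: cut_feasible_def P)
    show ?thesis
    proof (cases "keep z0 \<le> 0")
      case True
      have "keep z \<le> 0" if "z \<in> C" for z
        using sgn_keep[OF z0 that] True by (auto simp: sgn_if split: if_splits)
      then have "cut_optimal c A b (fst z) (snd z) x_LP" if "z \<in> C" for z
        using that x_LP opt by (auto simp: cut_opt keep_def)
      then show ?thesis by force
    next
      case False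
      have removed: "snd z < fst z \<bullet> x_LP" if "z \<in> C" for z
        using sgn_keep[OF z0 that] False by (auto simp: keep_def sgn_if split: if_splits)
      obtain E where E: "E \<in> ?\<E>" and cross0: "crossing A b E z0"
        and max0: "\<And>y. y \<in> ?P \<Longrightarrow> fst z0 \<bullet> y \<le> snd z0 \<Longrightarrow>
          c \<bullet> y \<le> c \<bullet> cramer_point A b E (fst z0) (snd z0)"
        using ex_optimal_crossing[OF bdd x_LP opt removed[OF z0] y0] by blast
      have "cramer_den A E z \<noteq> 0 \<and>
          cut_optimal c A b (fst z) (snd z) (cramer_point A b E (fst z) (snd z))" if z: "z \<in> C" for z
      proof -
        have cross: "crossing A b E z"
          using crossing_const[OF E z0 z cross0] .
        then have nz: "cramer_den A E z \<noteq> 0" and in_P: "cramer_point A b E (fst z) (snd z) \<in> ?P"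
          by (auto simp: crossing_def)
        have on_cut: "fst z \<bullet> cramer_point A b E (fst z) (snd z) = snd z"
          using E nz by (intro cramer_point_on_cut) auto
        \<comment> \<open>The optimum at \<open>z\<close> is attained at the Cramer point of some \<open>E'\<close>. That point is feasible
          at \<open>z0\<close> too, where it does not beat \<open>E\<close>; hence it does not beat \<open>E\<close> at \<open>z\<close> either.\<close>
        obtain E' where E': "E' \<in> ?\<E>" and cross': "crossing A b E' z"
          and max': "\<And>y. y \<in> ?P \<Longrightarrow> fst z \<bullet> y \<le> snd z \<Longrightarrow>
            c \<bullet> y \<le> c \<bullet> cramer_point A b E' (fst z) (snd z)"
          using ex_optimal_crossing[OF bdd x_LP opt removed[OF z] in_P eq_refl[OF on_cut]] by blast
        have cross0': "crossing A b E' z0"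
          using crossing_const[OF E' z z0 cross'] .
        have dens: "cramer_den A E' z0 \<noteq> 0" "cramer_den A E z0 \<noteq> 0" "cramer_den A E' z \<noteq> 0"
          using cross0' cross0 cross' by (auto simp: crossing_def)
        have "fst z0 \<bullet> cramer_point A b E' (fst z0) (snd z0) = snd z0"
          using E' dens(1) by (intro cramer_point_on_cut) auto
        then have "c \<bullet> cramer_point A b E' (fst z0) (snd z0)
            \<le> c \<bullet> cramer_point A b E (fst z0) (snd z0)"
          using cross0' by (intro max0) (auto simp: crossing_def)
        then have "c \<bullet> cramer_point A b E' (fst z) (snd z) \<le> c \<bullet> cramer_point A b E (fst z) (snd z)"
          unfolding objective_le_iff_sgn[OF dens(1,2)] objective_le_iff_sgn[OF dens(3) nz]
          using sgn_gap[OF E' E z0 z] sgn_den[OF E z0 z] sgn_den[OF E' z0 z] by simp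
        then show ?thesis
          using nz in_P on_cut max' by (force simp: cut_opt)
      qed
      then have "\<forall>(\<alpha>, \<beta>)\<in>C. det (cut_matrix A E \<alpha>) \<noteq> 0 \<and>
          cut_optimal c A b \<alpha> \<beta> (cramer_point A b E \<alpha> \<beta>)"
        by (force simp: cramer_den_def)
      then show ?thesis
        using E by blast
    qed
  qed

  have "finite \<H>" "finite \<Q>"
    by (auto simp: \<H>_def \<Q>_def)
  with card_\<H> hyper card_\<Q> quad main show ?thesis
    by (intro exI[of _ \<H>] exI[of _ \<Q>]) blast
qed

end
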